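(* Let $G$ be a graph. Then $\operatorname{th}_-(G)=1$ if and only if $G=K_1$ or $G=rK_2$ for some integer $r\ge 1$.
   Context: Graphs are finite, simple and undirected, with nonempty vertex set. Equality of graphs means isomorphism; $rK_2$ is the disjoint union of $r$ copies of $K_2$. Skew zero forcing: each vertex of $G$ is blue or white; initially exactly the vertices of a set $S\subseteq V(G)$ are blue. In each round, simultaneously, every vertex (blue or white) that has exactly one white neighbor at the start of the round colors that neighbor blue. If all vertices eventually become blue, $S$ is a skew zero forcing set, and the skew propagation time $\operatorname{pt}_-(G;S)$ is the number of rounds needed until all vertices are blue ($0$ if $S=V(G)$); otherwise $\operatorname{pt}_-(G;S)=\infty$. Define $\operatorname{th}_-(G;S)=|S|+\operatorname{pt}_-(G;S)$ and the skew throttling number $\operatorname{th}_-(G)=\min_{S\subseteq V(G)}\operatorname{th}_-(G;S)$. *)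

theory Defs
  imports "Graph_Theory.Graph_Theory" "HOL-Library.Extended_Nat"
begin

text \<open>
  The locale \<open>graph\<close> of the library models a finite simple undirected graph as a finite symmetric
  digraph without loops or parallel arcs; \<open>u \<rightarrow>\<^bsub>G\<^esub> v\<close> is the adjacency relation. The null graph is
  an instance, so nonemptiness of the vertex set has to be assumed separately.
\<close>

definition complete_graph :: "nat \<Rightarrow> (nat, nat \<times> nat) pre_digraph" where
  "complete_graph n =
     \<lparr> verts = {..<n}, arcs = {(u, v). u < n \<and> v < n \<and> u \<noteq> v}, tail = fst, head = snd \<rparr>"

definition disjoint_copies :: "nat \<Rightarrow> ('a, 'b) pre_digraph \<Rightarrow> (nat \<times> 'a, nat \<times> 'b) pre_digraph" where
  "disjoint_copies r G =
     \<lparr> verts = {..<r} \<times> verts G, arcs = {..<r} \<times> arcs G,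
       tail = map_prod id (tail G), head = map_prod id (head G) \<rparr>"

lemma complete_digraph_complete_graph: "complete_digraph n (complete_graph n)"
proof -
  have "finite {(u, v). u < n \<and> v < n \<and> u \<noteq> v}"
    by (rule finite_subset[of _ "{..<n} \<times> {..<n}"]) auto
  then have "graph (complete_graph n)"
    by unfold_locales
      (auto simp: complete_graph_def symmetric_conv arc_to_ends_def)
  then show ?thesis
    by (auto simp: complete_digraph_def complete_graph_def arcs_ends_conv)
qed

lemma graph_disjoint_copies:
  assumes "graph G"
  shows "graph (disjoint_copies r G)"
proof -
  interpret graph G by fact
  show ?thesis
  proof unfold_locales
    show "symmetric (disjoint_copies r G)"
      using sym_arcs by (fastforce simp: symmetric_conv disjoint_copies_def)
  qed (auto simp: disjoint_copies_def arc_to_ends_def dest: no_loops intro: no_multi_arcs)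
qed

text \<open>
  In the definitions below the set \<open>B\<close> (resp. \<open>S\<close>) is the set of blue vertices. The forcing
  vertex \<open>v\<close> may itself be white.
\<close>

definition white_neighbors :: "('a, 'b) pre_digraph \<Rightarrow> 'a set \<Rightarrow> 'a \<Rightarrow> 'a set" where
  "white_neighbors G B v = {u \<in> verts G. v \<rightarrow>\<^bsub>G\<^esub> u \<and> u \<notin> B}"

definition skew_round :: "('a, 'b) pre_digraph \<Rightarrow> 'a set \<Rightarrow> 'a set" where
  "skew_round G B = B \<union> {w. \<exists>v \<in> verts G. white_neighbors G B v = {w}}"

definition blue_after :: "('a, 'b) pre_digraph \<Rightarrow> 'a set \<Rightarrow> nat \<Rightarrow> 'a set" where
  "blue_after G S t = (skew_round G ^^ t) S"

definition skew_zero_forcing_set :: "('a, 'b) pre_digraph \<Rightarrow> 'a set \<Rightarrow> bool" where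
  "skew_zero_forcing_set G S \<longleftrightarrow> S \<subseteq> verts G \<and> (\<exists>t. blue_after G S t = verts G)"

definition skew_propagation_time :: "('a, 'b) pre_digraph \<Rightarrow> 'a set \<Rightarrow> enat" where
  "skew_propagation_time G S =
     (if skew_zero_forcing_set G S then enat (LEAST t. blue_after G S t = verts G) else \<infinity>)"

definition skew_throttling_of :: "('a, 'b) pre_digraph \<Rightarrow> 'a set \<Rightarrow> enat" where
  "skew_throttling_of G S = enat (card S) + skew_propagation_time G S"

definition skew_throttling_number :: "('a, 'b) pre_digraph \<Rightarrow> enat" where
  "skew_throttling_number G = Min (skew_throttling_of G ` Pow (verts G))"

end

(* Total cost 1 leaves two possibilities. Either one blue vertex and no round, so G is a single
   vertex; or no blue vertex and one round, in which case every vertex w has a neighbour f w whose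
   only neighbour is w. Then f is injective, hence by finiteness a permutation of the vertices, so
   every vertex has exactly one neighbour and G is a perfect matching. *)
theory Submission
  imports Defs
begin

section \<open>Isomorphism in terms of vertices and adjacency\<close>

text \<open>Without parallel arcs an arc is determined by its pair of ends, so the vertex bijection
  already induces the arc bijection that \<open>digraph_iso\<close> also asks for.\<close>

lemma digraph_isoI:
  assumes G: "nomulti_digraph G" and H: "nomulti_digraph H"
    and f: "bij_betw f (verts G) (verts H)"
    and adj: "\<And>u v. u \<in> verts G \<Longrightarrow> v \<in> verts G \<Longrightarrow> u \<rightarrow>\<^bsub>G\<^esub> v \<longleftrightarrow> f u \<rightarrow>\<^bsub>H\<^esub> f v"
  shows "digraph_iso G H"
proof -
  interpret G: nomulti_digraph G by fact
  interpret H: nomulti_digraph H by fact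
  have bG: "bij_betw (arc_to_ends G) (arcs G) (arcs_ends G)"
    unfolding arcs_ends_def by (rule inj_on_imp_bij_betw[OF G.inj_on_arc_to_ends])
  have bH: "bij_betw (arc_to_ends H) (arcs H) (arcs_ends H)"
    unfolding arcs_ends_def by (rule inj_on_imp_bij_betw[OF H.inj_on_arc_to_ends])
  have bf: "bij_betw (map_prod f f) (arcs_ends G) (arcs_ends H)"
    unfolding bij_betw_def
  proof
    have "inj_on (map_prod f f) (verts G \<times> verts G)"
      using f by (auto intro: map_prod_inj_on simp: bij_betw_def)
    then show "inj_on (map_prod f f) (arcs_ends G)"
      by (rule inj_on_subset) (auto dest: G.adj_in_verts)
    show "map_prod f f ` arcs_ends G = arcs_ends H"
    proof (intro equalityI subsetI)
      fix e assume "e \<in> map_prod f f ` arcs_ends G"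
      then show "e \<in> arcs_ends H" using adj by (auto dest: G.adj_in_verts)
    next
      fix e assume e: "e \<in> arcs_ends H"
      obtain x y where xy: "e = (x, y)" by (cases e)
      with e have "x \<in> f ` verts G" "y \<in> f ` verts G"
        using f by (auto simp: bij_betw_def dest: H.adj_in_verts)
      then obtain u v where "u \<in> verts G" "v \<in> verts G" "x = f u" "y = f v" by blast
      with e xy adj show "e \<in> map_prod f f ` arcs_ends G" by force
    qed
  qed
  \<comment> \<open>Read off the ends of an arc, move both by \<open>f\<close>, and return to the
    only arc of \<open>H\<close> with these ends.\<close>
  define g where "g = the_inv_into (arcs H) (arc_to_ends H) \<circ> (map_prod f f \<circ> arc_to_ends G)"
  have bg: "bij_betw g (arcs G) (arcs H)"
    unfolding g_def
    by (rule bij_betw_trans[OF bij_betw_trans[OF bG bf] bij_betw_the_inv_into[OF bH]])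
  have ends: "arc_to_ends H (g a) = map_prod f f (arc_to_ends G a)" if "a \<in> arcs G" for a
  proof -
    have "map_prod f f (arc_to_ends G a) \<in> arcs_ends H"
      using that bG bf by (auto simp: bij_betw_def)
    then show ?thesis
      using bH by (simp add: g_def f_the_inv_into_f_bij_betw)
  qed
  \<comment> \<open>\<open>digraph_iso\<close> demands equality of records. Taking
    \<open>head H\<close> and \<open>tail H\<close> themselves makes these fields agree even off the
    arcs.\<close>
  define h where "h = \<lparr>iso_verts = f, iso_arcs = g, iso_head = head H, iso_tail = tail H\<rparr>"
  have "G.digraph_isomorphism h"
    unfolding G.digraph_isomorphism_def
    using G.wf_digraph f bg ends by (auto simp: h_def bij_betw_def arc_to_ends_def)
  moreover have "H = app_iso h G"
    using f bg by (intro pre_digraph.equality) (auto simp: h_def bij_betw_def)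
  ultimately show ?thesis
    unfolding digraph_iso_def by blast
qed

lemma digraph_isoE:
  assumes "digraph_iso G H"
  obtains f where "bij_betw f (verts G) (verts H)"
    "\<And>u v. u \<in> verts G \<Longrightarrow> v \<in> verts G \<Longrightarrow> u \<rightarrow>\<^bsub>G\<^esub> v \<longleftrightarrow> f u \<rightarrow>\<^bsub>H\<^esub> f v"
proof -
  obtain h where h: "pre_digraph.digraph_isomorphism G h" and H: "H = app_iso h G"
    using assms unfolding digraph_iso_def by blast
  interpret wf_digraph G
    using h by (simp add: pre_digraph.digraph_isomorphism_def)
  show thesis
  proof (rule that[of "iso_verts h"])
    show inj: "bij_betw (iso_verts h) (verts G) (verts H)"
      using h H by (simp add: bij_betw_def digraph_isomorphism_def)
    show "u \<rightarrow>\<^bsub>G\<^esub> v \<longleftrightarrow> iso_verts h u \<rightarrow>\<^bsub>H\<^esub> iso_verts h v"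
      if "u \<in> verts G" "v \<in> verts G" for u v
    proof -
      \<comment> \<open>An arc of the image comes from some arc of \<open>G\<close>, whose ends a
        priori only have the same images as \<open>u\<close> and \<open>v\<close>; injectivity on
        the vertices then identifies them.\<close>
      have "iso_verts h u \<rightarrow>\<^bsub>H\<^esub> iso_verts h v \<longleftrightarrow> (\<exists>a b. a \<rightarrow>\<^bsub>G\<^esub> b \<and>
          iso_verts h u = iso_verts h a \<and> iso_verts h v = iso_verts h b)"
        using h by (force simp: H arcs_ends_app_iso_eq)
      then show ?thesis
        using that h by (metis adj_in_verts iso_verts_eq_iff)
    qed
  qed
qed

section \<open>Recognising K_1 and the disjoint unions of copies of K_2\<close>

lemma graph_complete_graph: "graph (complete_graph n)"
  using complete_digraph_complete_graph by (simp add: complete_digraph_def)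

lemma verts_complete_graph [simp]: "verts (complete_graph n) = {..<n}"
  by (simp add: complete_graph_def)

lemma complete_graph_dominates:
  "u \<rightarrow>\<^bsub>complete_graph n\<^esub> v \<longleftrightarrow> u < n \<and> v < n \<and> u \<noteq> v"
  by (auto simp: complete_graph_def arcs_ends_conv)

lemma verts_disjoint_copies [simp]: "verts (disjoint_copies r G) = {..<r} \<times> verts G"
  by (simp add: disjoint_copies_def)

lemma disjoint_copies_dominates:
  "(i, u) \<rightarrow>\<^bsub>disjoint_copies r G\<^esub> (j, v) \<longleftrightarrow> i < r \<and> i = j \<and> u \<rightarrow>\<^bsub>G\<^esub> v"
  by (force simp: disjoint_copies_def arcs_ends_conv)

lemma (in graph) digraph_iso_complete_graph_1_iff:
  "digraph_iso G (complete_graph 1) \<longleftrightarrow> card (verts G) = 1"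
proof
  assume "digraph_iso G (complete_graph 1)"
  then show "card (verts G) = 1"
    by (rule digraph_isoE) (auto dest: bij_betw_same_card)
next
  assume "card (verts G) = 1"
  then obtain v where v: "verts G = {v}" by (rule card_1_singletonE)
  interpret K: graph "complete_graph 1" by (rule graph_complete_graph)
  show "digraph_iso G (complete_graph 1)"
  proof (rule digraph_isoI)
    show "nomulti_digraph G" "nomulti_digraph (complete_graph 1)" by unfold_locales
    show "bij_betw (\<lambda>_. 0) (verts G) (verts (complete_graph 1))"
      by (auto simp: v bij_betw_def)
  qed (auto simp: v complete_graph_dominates dest: adj_not_same)
qed

text \<open>
  The set \<open>A\<close> below contains one end of each edge; it indexes the copies of \<open>K\<^sub>2\<close>.
\<close>

lemma (in graph) digraph_iso_copies_K2I:
  assumes deg: "\<And>v. v \<in> verts G \<Longrightarrow> \<exists>!u. v \<rightarrow>\<^bsub>G\<^esub> u" and ne: "verts G \<noteq> {}"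
  shows "\<exists>r\<ge>1. digraph_iso G (disjoint_copies r (complete_graph 2))"
proof -
  \<comment> \<open>The partner in the perfect matching; the facts below make \<open>m\<close> an
    involution of the vertices without fixed points.\<close>
  define m where "m v = (THE u. v \<rightarrow>\<^bsub>G\<^esub> u)" for v
  have m: "v \<rightarrow>\<^bsub>G\<^esub> u \<longleftrightarrow> u = m v" if "v \<in> verts G" for u v
  proof -
    have "v \<rightarrow>\<^bsub>G\<^esub> m v" unfolding m_def by (rule theI'[OF deg[OF that]])
    then show ?thesis using deg[OF that] by blast
  qed
  have mV: "m v \<in> verts G" if "v \<in> verts G" for v
    using that m adj_in_verts(2) by blast
  have mm: "m (m v) = v" if "v \<in> verts G" for v
    using that m mV arcs_ends_symmetric[OF sym_arcs] by metis
  have mne: "m v \<noteq> v" if "v \<in> verts G" for v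
    using that m adj_not_same by metis
  \<comment> \<open>Both ends of an edge give the same set \<open>{v, m v}\<close>, hence the same
    chosen element, so exactly one of them lies in \<open>A\<close>. This replaces a comparison, as
    the vertex type carries no order.\<close>
  define A where "A = {v \<in> verts G. v = (SOME x. x \<in> {v, m v})}"
  have A: "m v \<in> A \<longleftrightarrow> v \<notin> A" if "v \<in> verts G" for v
  proof -
    define s where "s = (SOME x. x \<in> {v, m v})"
    have "s \<in> {v, m v}"
      unfolding s_def by (rule someI_ex) blast
    moreover have "m v \<in> A \<longleftrightarrow> m v = s" "v \<in> A \<longleftrightarrow> v = s"
      using that mV[OF that] by (simp_all add: A_def s_def mm disj_commute)
    ultimately show ?thesis
      using mne[OF that] by auto
  qed
  have AV: "v \<in> verts G" if "v \<in> A" for v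
    using that by (simp add: A_def)
  then have "finite A" by (auto intro: finite_subset[OF _ finite_verts])
  then obtain g where g: "bij_betw g A {..<card A}"
    using finite_same_card_bij[of A "{..<card A}"] by auto
  have gA: "g u = g v \<longleftrightarrow> u = v" if "u \<in> A" "v \<in> A" for u v
    using that g by (auto simp: bij_betw_def dest: inj_onD)
  have gr: "g u < card A" if "u \<in> A" for u
    using that g by (auto simp: bij_betw_def)
  \<comment> \<open>\<open>g\<close> numbers the edges by their ends in \<open>A\<close>. Such an
    end becomes vertex 0 of its copy of K_2, and its partner becomes vertex 1 of the same
    copy.\<close>
  define f where "f v = (if v \<in> A then (g v, 0::nat) else (g (m v), 1))" for v
  have "A \<noteq> {}" using ne A by blast
  with \<open>finite A\<close> have r: "card A \<ge> 1" by (simp add: Suc_le_eq card_gt_0_iff)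
  interpret H: graph "disjoint_copies (card A) (complete_graph 2)"
    by (rule graph_disjoint_copies[OF graph_complete_graph])
  have "digraph_iso G (disjoint_copies (card A) (complete_graph 2))"
  proof (rule digraph_isoI)
    show "nomulti_digraph G" "nomulti_digraph (disjoint_copies (card A) (complete_graph 2))"
      by unfold_locales
    show "bij_betw f (verts G) (verts (disjoint_copies (card A) (complete_graph 2)))"
      unfolding bij_betw_def
    proof
      show "inj_on f (verts G)"
      proof (rule inj_onI)
        fix u v assume uv: "u \<in> verts G" "v \<in> verts G" "f u = f v"
        \<comment> \<open>Equal second components put \<open>u\<close> and \<open>v\<close> on the
          same side of \<open>A\<close>; equal first components then identify the vertices or their
          partners.\<close>
        have "u = v \<or> m u = m v"
          using uv(3) A[OF uv(1)] A[OF uv(2)] by (auto simp: f_def gA split: if_splits)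
        then show "u = v"
          using mm[OF uv(1)] mm[OF uv(2)] by metis
      qed
      show "f ` verts G = verts (disjoint_copies (card A) (complete_graph 2))"
      proof (intro equalityI subsetI)
        fix x assume "x \<in> f ` verts G"
        then show "x \<in> verts (disjoint_copies (card A) (complete_graph 2))"
          using A gr by (auto simp: f_def)
      next
        fix x assume "x \<in> verts (disjoint_copies (card A) (complete_graph 2))"
        then obtain i k where x: "x = (i, k)" "i < card A" "k < 2" by auto
        then obtain a where a: "a \<in> A" "i = g a"
          using g by (auto simp: bij_betw_def)
        have "x = f (if k = 0 then a else m a)"
          using x a A[OF AV[OF a(1)]] mm[OF AV[OF a(1)]] by (auto simp: f_def)
        then show "x \<in> f ` verts G"
          using AV[OF a(1)] mV by auto
      qed
    qed
    show "u \<rightarrow>\<^bsub>G\<^esub> v \<longleftrightarrow> f u \<rightarrow>\<^bsub>disjoint_copies (card A) (complete_graph 2)\<^esub> f v"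
      if "u \<in> verts G" "v \<in> verts G" for u v
      using that A[OF that(1)] A[OF that(2)] mm[OF that(1)] mm[OF that(2)] m gA gr
      by (auto simp: f_def disjoint_copies_dominates complete_graph_dominates)
  qed
  with r show ?thesis by blast
qed

lemma copies_K2_unique_neighbor:
  assumes "digraph_iso G (disjoint_copies r (complete_graph 2))" and "graph G" and "v \<in> verts G"
  shows "\<exists>!u. v \<rightarrow>\<^bsub>G\<^esub> u"
proof -
  let ?H = "disjoint_copies r (complete_graph 2)"
  interpret graph G by fact
  interpret H: graph ?H
    by (rule graph_disjoint_copies[OF graph_complete_graph])
  obtain f where f: "bij_betw f (verts G) (verts ?H)"
    and adj: "\<And>u v. u \<in> verts G \<Longrightarrow> v \<in> verts G \<Longrightarrow> u \<rightarrow>\<^bsub>G\<^esub> v \<longleftrightarrow> f u \<rightarrow>\<^bsub>?H\<^esub> f v"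
    using digraph_isoE[OF assms(1)] by blast
  obtain i k where fv: "f v = (i, k)" by (cases "f v")
  have "f v \<in> verts ?H"
    using f assms(3) by (rule bij_betwE[rule_format])
  then have ik: "i < r" "k < 2"
    by (auto simp: fv)
  \<comment> \<open>The copy has vertices 0 and 1, so for \<open>k < 2\<close> the truncated
    difference \<open>1 - k\<close> is the end opposite to \<open>k\<close>.\<close>
  then have nb: "f v \<rightarrow>\<^bsub>?H\<^esub> y \<longleftrightarrow> y = (i, 1 - k)" for y
    by (cases y, cases "k = 0") (auto simp: fv disjoint_copies_dominates complete_graph_dominates)
  have "(i, 1 - k) \<in> verts ?H" using ik by auto
  then obtain u where u: "u \<in> verts G" "f u = (i, 1 - k)"
    using f by (metis bij_betw_imp_surj_on imageE)
  have "v \<rightarrow>\<^bsub>G\<^esub> w \<longleftrightarrow> w = u" for w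
  proof
    assume "v \<rightarrow>\<^bsub>G\<^esub> w"
    then have w: "w \<in> verts G" by (rule adj_in_verts)
    with \<open>v \<rightarrow>\<^bsub>G\<^esub> w\<close> have "f w = f u"
      using adj[OF assms(3) w] nb u(2) by simp
    then show "w = u"
      by (rule inj_onD[OF bij_betw_imp_inj_on[OF f] _ w u(1)])
  next
    assume "w = u"
    then show "v \<rightarrow>\<^bsub>G\<^esub> w" using adj[OF assms(3) u(1)] nb u(2) by simp
  qed
  then show ?thesis by simp
qed

section \<open>One round from the all-white state\<close>

text \<open>With no blue vertex, a vertex forces exactly when it has degree one. Finiteness bridges
  the gap between every vertex being forced and every vertex forcing.\<close>

lemma (in graph) skew_round_empty_iff:
  "skew_round G {} = verts G \<longleftrightarrow> (\<forall>v \<in> verts G. \<exists>!u. v \<rightarrow>\<^bsub>G\<^esub> u)"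
proof -
  have nb: "white_neighbors G {} v = {w} \<longleftrightarrow> (\<forall>u. v \<rightarrow>\<^bsub>G\<^esub> u \<longleftrightarrow> u = w)" for v w
    unfolding white_neighbors_def by (auto dest: adj_in_verts)
  show ?thesis
  proof
    assume eq: "skew_round G {} = verts G"
    have "\<exists>v \<in> verts G. \<forall>u. v \<rightarrow>\<^bsub>G\<^esub> u \<longleftrightarrow> u = w" if "w \<in> verts G" for w
    proof -
      have "w \<in> skew_round G {}" using that eq by simp
      then show ?thesis unfolding skew_round_def nb by simp
    qed
    then obtain f where f: "\<And>w. w \<in> verts G \<Longrightarrow> f w \<in> verts G"
      "\<And>w u. w \<in> verts G \<Longrightarrow> f w \<rightarrow>\<^bsub>G\<^esub> u \<longleftrightarrow> u = w"
      by metis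
    \<comment> \<open>The sole neighbor of \<open>f w\<close> is \<open>w\<close>, so
      \<open>f w\<close> determines \<open>w\<close>. Being onto as well, \<open>f\<close> reaches
      every vertex, which thus has a sole neighbor.\<close>
    have "inj_on f (verts G)" using f(2) by (metis inj_onI)
    then have "f ` verts G = verts G"
      using f(1) by (intro endo_inj_surj) auto
    then show "\<forall>v \<in> verts G. \<exists>!u. v \<rightarrow>\<^bsub>G\<^esub> u"
      using f(2) by (metis imageE)
  next
    assume deg: "\<forall>v \<in> verts G. \<exists>!u. v \<rightarrow>\<^bsub>G\<^esub> u"
    \<comment> \<open>The neighbor \<open>v\<close> of \<open>w\<close> is adjacent to
      \<open>w\<close> by symmetry, and its only neighbor is therefore \<open>w\<close>.\<close>
    have "\<exists>v \<in> verts G. \<forall>u. v \<rightarrow>\<^bsub>G\<^esub> u \<longleftrightarrow> u = w" if w: "w \<in> verts G" for w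
    proof -
      obtain v where "w \<rightarrow>\<^bsub>G\<^esub> v" using deg w by blast
      then have "v \<rightarrow>\<^bsub>G\<^esub> w" by (rule arcs_ends_symmetric[OF sym_arcs])
      then show ?thesis using deg adj_in_verts by metis
    qed
    then show "skew_round G {} = verts G"
      unfolding skew_round_def nb by (auto dest: adj_in_verts)
  qed
qed

section \<open>Propagation time and throttling values 0 and 1\<close>

text \<open>Trades \<open>LEAST\<close> and the infinite case for conditions that can be evaluated
  directly at times 0 and 1.\<close>

lemma skew_propagation_time_eq_enat_iff:
  "skew_propagation_time G S = enat k \<longleftrightarrow>
    S \<subseteq> verts G \<and> blue_after G S k = verts G \<and> (\<forall>j<k. blue_after G S j \<noteq> verts G)"
    (is "_ \<longleftrightarrow> ?R")
proof
  assume "skew_propagation_time G S = enat k"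
  then have "skew_zero_forcing_set G S" and k: "k = (LEAST t. blue_after G S t = verts G)"
    by (auto simp: skew_propagation_time_def split: if_splits)
  then show ?R
    unfolding skew_zero_forcing_set_def k
    by (metis (mono_tags, lifting) LeastI_ex not_less_Least)
next
  assume R: ?R
  then have "(LEAST t. blue_after G S t = verts G) = k"
    by (intro Least_equality) (auto simp: not_less[symmetric])
  with R show "skew_propagation_time G S = enat k"
    by (auto simp: skew_propagation_time_def skew_zero_forcing_set_def)
qed

text \<open>Time 0 means that all vertices are blue from the start. On a nonempty graph this yields
  the lower bound 1 for every throttling value.\<close>

lemma (in graph) skew_throttling_of_eq_0_iff:
  assumes "S \<subseteq> verts G"
  shows "skew_throttling_of G S = 0 \<longleftrightarrow> S = {} \<and> verts G = {}"
proof -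
  have fin: "finite S" using assms finite_verts by (rule finite_subset)
  have "skew_throttling_of G S = 0 \<longleftrightarrow> card S = 0 \<and> skew_propagation_time G S = enat 0"
    unfolding skew_throttling_of_def by (cases "skew_propagation_time G S") (auto simp: zero_enat_def)
  also have "\<dots> \<longleftrightarrow> S = {} \<and> verts G = {}"
    using fin by (auto simp: skew_propagation_time_eq_enat_iff blue_after_def)
  finally show ?thesis .
qed

lemma (in graph) skew_throttling_of_eq_1_iff:
  assumes "S \<subseteq> verts G" "verts G \<noteq> {}"
  shows "skew_throttling_of G S = 1 \<longleftrightarrow>
    S = verts G \<and> card (verts G) = 1 \<or> S = {} \<and> skew_round G {} = verts G"
proof -
  have fin: "finite S" using assms(1) finite_verts by (rule finite_subset)
  \<comment> \<open>A sum equal to 1 splits as 1 + 0 or 0 + 1, and an infinite time is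
    excluded.\<close>
  have "skew_throttling_of G S = 1 \<longleftrightarrow>
    card S = 1 \<and> skew_propagation_time G S = enat 0 \<or>
    card S = 0 \<and> skew_propagation_time G S = enat 1"
    unfolding skew_throttling_of_def
    by (cases "skew_propagation_time G S") (auto simp: one_enat_def add_is_1)
  \<comment> \<open>Time exactly 1 also requires that the vertices are not all blue at time 0; for
    \<open>S = {}\<close> this is nonemptiness of the graph.\<close>
  also have "\<dots> \<longleftrightarrow> S = verts G \<and> card (verts G) = 1 \<or> S = {} \<and> skew_round G {} = verts G"
    using assms fin by (auto simp: skew_propagation_time_eq_enat_iff blue_after_def)
  finally show ?thesis .
qed

lemma (in graph) skew_throttling_number_eq_1_iff:
  assumes ne: "verts G \<noteq> {}"
  shows "skew_throttling_number G = 1 \<longleftrightarrow> card (verts G) = 1 \<or> skew_round G {} = verts G"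
proof -
  let ?T = "skew_throttling_of G ` Pow (verts G)"
  have "x \<noteq> 0" if x: "x \<in> ?T" for x
  proof -
    obtain S where "S \<subseteq> verts G" "x = skew_throttling_of G S" using x by auto
    then show ?thesis using ne by (simp add: skew_throttling_of_eq_0_iff)
  qed
  then have "1 \<le> x" if "x \<in> ?T" for x
    unfolding one_eSuc using that by (intro ileI1) (simp add: zero_less_iff_neq_zero)
  \<comment> \<open>As 1 bounds the finite set of values from below, it is their minimum exactly
    when some \<open>S\<close> attains it.\<close>
  then have "skew_throttling_number G = 1 \<longleftrightarrow> 1 \<in> ?T"
    unfolding skew_throttling_number_def by (subst Min_eq_iff) auto
  also have "\<dots> \<longleftrightarrow> (\<exists>S \<subseteq> verts G. skew_throttling_of G S = 1)"
    by (auto simp: image_iff Bex_def eq_commute[of "1::enat"])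
  also have "\<dots> \<longleftrightarrow> card (verts G) = 1 \<or> skew_round G {} = verts G"
    by (auto simp: skew_throttling_of_eq_1_iff[OF _ ne] cong: conj_cong)
  finally show ?thesis .
qed

theorem proposition2p1:
  fixes G :: "('a, 'b) pre_digraph"
  assumes "graph G" and "verts G \<noteq> {}"
  shows "skew_throttling_number G = 1 \<longleftrightarrow>
    digraph_iso G (complete_graph 1) \<or>
    (\<exists>r::nat. r \<ge> 1 \<and> digraph_iso G (disjoint_copies r (complete_graph 2)))"
proof -
  interpret graph G by fact
  have "(\<forall>v \<in> verts G. \<exists>!u. v \<rightarrow>\<^bsub>G\<^esub> u) \<longleftrightarrow>
      (\<exists>r::nat. r \<ge> 1 \<and> digraph_iso G (disjoint_copies r (complete_graph 2)))"
    using digraph_iso_copies_K2I[OF _ assms(2)] copies_K2_unique_neighbor[OF _ assms(1)] by blast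
  then show ?thesis
    by (simp only: skew_throttling_number_eq_1_iff[OF assms(2)] skew_round_empty_iff
        digraph_iso_complete_graph_1_iff)
qed

end
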